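(* Let $(x_n)_{n \geq 1}$ be a sequence of real numbers in $[0,1]$. Assume that there is a function $G$ on $[0,1]$ such that $$G(x) = \lim_{N \to \infty} \frac{1}{N}\, \#\{1 \leq n \leq N : x_n \in [0,x]\}, \qquad x \in [0,1].$$ Assume also that there is a function $F : [0,\infty) \to [0,\infty]$ such that for every $s > 0$, $$F(s) = \lim_{N \to \infty} \frac{1}{N}\, \#\left\{ (m,n):\ 1 \leq m,n \leq N,\ m \neq n,\ \|x_m - x_n\| \leq \frac{s}{N} \right\}.$$ Then: (i) if $G$ is not absolutely continuous, then $F(s) = \infty$ for all $s > 0$; (ii) if $G$ is absolutely continuous, then, writing $g$ for the density of the probability measure on $[0,1]$ with distribution function $G$, $$\limsup_{s \to \infty} \frac{F(s)}{2s} \geq \int_0^1 g(x)^2\, dx.$$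
   Context: For a real number $x$, $\|x\|$ denotes the distance from $x$ to the nearest integer. The limits defining $F(s)$ are allowed to be $+\infty$. "Absolutely continuous" for $G$ means the measure $\mu_G$ determined by $G$ is absolutely continuous with respect to Lebesgue measure on $[0,1]$. *)

theory Defs
  imports "HOL-Analysis.Analysis"
begin

definition dist_nearest_int :: "real \<Rightarrow> real" where
  "dist_nearest_int x = \<bar>x - real_of_int (round x)\<bar>"

definition pair_count :: "(nat \<Rightarrow> real) \<Rightarrow> real \<Rightarrow> nat \<Rightarrow> nat" where
  "pair_count x s N =
     card {(m, n). m \<in> {1..N} \<and> n \<in> {1..N} \<and> m \<noteq> n \<and>
                   dist_nearest_int (x m - x n) \<le> s / real N}"

(* A pointwise limit G of empirical distribution functions is nondecreasing but need not be
   right-continuous (take x_n = 1/2 + 1/(n+1) and the point 1/2).  The measure determined by G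
   is therefore the Lebesgue-Stieltjes measure of the right limits of G, extended by 0 to the
   left of 0 and by G 1 to the right of 1; since G is nondecreasing, the infimum below is the
   right limit.  The extension by 0 makes G(0+) the mass of the point 0. *)

definition cdf_extension :: "(real \<Rightarrow> real) \<Rightarrow> real \<Rightarrow> real" where
  "cdf_extension G x =
     (if x < 0 then 0 else if x < 1 then Inf (G ` {x<..1}) else G 1)"

definition cdf_measure :: "(real \<Rightarrow> real) \<Rightarrow> real measure" where
  "cdf_measure G = restrict_space (interval_measure (cdf_extension G)) {0..1}"

abbreviation unit_lebesgue :: "real measure" where
  "unit_lebesgue \<equiv> restrict_space lborel {0..1}"

definition abs_cont_cdf :: "(real \<Rightarrow> real) \<Rightarrow> bool" where
  "abs_cont_cdf G \<longleftrightarrow> absolutely_continuous unit_lebesgue (cdf_measure G)"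

(* Densities are taken with values in [0, \<infinity>], so that every version of the
   Radon-Nikodym derivative is covered. *)

definition is_density_of :: "(real \<Rightarrow> ennreal) \<Rightarrow> (real \<Rightarrow> real) \<Rightarrow> bool" where
  "is_density_of g G \<longleftrightarrow>
     g \<in> borel_measurable unit_lebesgue \<and> density unit_lebesgue g = cdf_measure G"

end

theory Submission
  imports Defs "HOL-Probability.Probability"
begin

text \<open>
  Fix a continuous square-integrable test function \<open>\<phi>\<close>, let \<open>h = s / N\<close>, and let \<open>c t\<close> be the number
  of \<open>n \<le> N\<close> with \<open>t \<in> [x n - h, x n]\<close>. Expanding \<open>0 \<le> \<integral>(c / s - \<phi>)\<^sup>2\<close>, the term \<open>\<integral>c\<^sup>2\<close> is the sum of
  \<open>max 0 (h - |x m - x n|)\<close> over all pairs, and the mixed term tends to \<open>2 \<integral>\<phi> d\<nu>\<close>, where \<open>\<nu>\<close> is the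
  limit distribution. The tent \<open>max 0 (1 - d / s)\<close> is at most the average of the indicators of
  \<open>d \<le> s k / K\<close> over \<open>1 \<le> k \<le> K\<close>; using the average instead of the single indicator of \<open>d \<le> s\<close> is
  what produces the factor 2 in \<open>F s / (2 s)\<close>. With \<open>s = K \<delta>\<close> this yields, for all \<open>K\<close> and \<open>\<delta>\<close>,
  \<open>1 + (F \<delta> + F (2 \<delta>) + \<dots> + F (K \<delta>)) / K \<ge> K \<delta> (2 \<integral>\<phi> d\<nu> - \<integral>\<phi>\<^sup>2)\<close>.
  If \<open>\<nu>\<close> charges a compact null set, multiples of continuous functions decreasing to its indicator
  make the right-hand side unbounded. If \<open>\<nu>\<close> has density \<open>g\<close>, letting \<open>\<phi>\<close> approximate the
  truncations \<open>min g M\<close> makes the bracket approach a number that is at least \<open>\<integral>(min g M)\<^sup>2\<close>.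
\<close>

section \<open>Tents and averages of indicators\<close>

text \<open>The admissible k start at y = max 1 \<lceil>d / \<delta>\<rceil>, which is at most d /
  \<delta> + 1, so at least K - d / \<delta> of them remain up to K. The maximum with 1 matters for
  d = 0, where the ceiling is 0.\<close>

lemma card_multiples_ge:
  fixes d \<delta> :: real
  assumes "0 \<le> d" "0 < \<delta>"
  shows "real K * max 0 (1 - d / (real K * \<delta>)) \<le> real (card {k \<in> {1..K}. d \<le> \<delta> * real k})"
proof (cases "K = 0")
  case False
  define y where "y = max 1 (nat \<lceil>d / \<delta>\<rceil>)"
  have "{y..K} \<subseteq> {k \<in> {1..K}. d \<le> \<delta> * real k}"
  proof
    fix k assume "k \<in> {y..K}"
    hence k: "1 \<le> k" "k \<le> K" "nat \<lceil>d / \<delta>\<rceil> \<le> k" by (auto simp: y_def)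
    have "d / \<delta> \<le> real k" using k(3) by linarith
    with k assms show "k \<in> {k \<in> {1..K}. d \<le> \<delta> * real k}"
      by (simp add: field_simps)
  qed
  hence le: "real (Suc K - y) \<le> real (card {k \<in> {1..K}. d \<le> \<delta> * real k})"
    using card_mono[of "{k \<in> {1..K}. d \<le> \<delta> * real k}" "{y..K}"] by simp
  have nn: "0 \<le> d / \<delta>" using assms by simp
  hence "real y \<le> d / \<delta> + 1"
    unfolding y_def by linarith
  hence "real K - d / \<delta> \<le> real (Suc K - y)" by linarith
  moreover have "real K * (1 - d / (real K * \<delta>)) = real K - d / \<delta>"
    using False assms by (simp add: field_simps)
  ultimately show ?thesis using le by (auto simp: max_def)
qed auto

section \<open>Energy estimate and pair counts for finitely many points\<close>

lemma integral_indicator_Icc_overlap: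
  fixes a b h :: real
  shows "(\<integral>t. indicator {a-h..a} t * indicator {b-h..b} t \<partial>lborel) = max 0 (h - \<bar>a - b\<bar>)"
proof -
  have "(\<lambda>t. indicator {a-h..a} t * indicator {b-h..b} t :: real) = indicator {max a b - h..min a b}"
    by (auto simp: indicator_def fun_eq_iff)
  thus ?thesis by (auto simp: max_def min_def abs_if)
qed

text \<open>The integral of (c / s - \<phi>)^2 is nonnegative, where c is the sum of the indicators
  \<open>I n\<close>. The window length h and the normalisation s are independent here; they are
  tied by h = s / N only later.\<close>

lemma energy_inequality:
  fixes x :: "'i \<Rightarrow> real" and \<phi> :: "real \<Rightarrow> real"
  assumes cont: "continuous_on UNIV \<phi>" and sq: "integrable lborel (\<lambda>t. (\<phi> t)\<^sup>2)"
    and A: "finite A" and s: "0 < s"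
  shows "2 * (\<Sum>n\<in>A. LBINT t:{x n - h..x n}. \<phi> t) / s
    \<le> (\<Sum>m\<in>A. \<Sum>n\<in>A. max 0 (h - \<bar>x m - x n\<bar>)) / s\<^sup>2 + (\<integral>t. (\<phi> t)\<^sup>2 \<partial>lborel)"
proof -
  define I :: "'i \<Rightarrow> real \<Rightarrow> real" where "I = (\<lambda>n. indicator {x n - h..x n})"
  have int\<phi>: "integrable lborel (\<lambda>t. I n t * \<phi> t)" for n
    using borel_integrable_atLeastAtMost'[of "x n - h" "x n" \<phi>] continuous_on_subset[OF cont]
    by (auto simp: I_def set_integrable_def)
  have intII: "integrable lborel (\<lambda>t. I m t * I n t)" for m n
  proof -
    have "(\<lambda>t. I m t * I n t) = indicator ({x m - h..x m} \<inter> {x n - h..x n})"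
      by (auto simp: I_def indicator_def fun_eq_iff)
    thus ?thesis by (simp add: emeasure_lborel_Icc_eq)
  qed
  have expand: "((\<Sum>n\<in>A. I n t) / s - \<phi> t)\<^sup>2
      = (\<Sum>m\<in>A. \<Sum>n\<in>A. I m t * I n t) / s\<^sup>2 - 2 * (\<Sum>n\<in>A. I n t * \<phi> t) / s + (\<phi> t)\<^sup>2" for t
    unfolding sum_product[symmetric] sum_distrib_right[symmetric]
    using s by (simp add: power2_eq_square field_simps)
  have "0 \<le> (\<integral>t. ((\<Sum>n\<in>A. I n t) / s - \<phi> t)\<^sup>2 \<partial>lborel)" by simp
  also have "\<dots> = (\<Sum>m\<in>A. \<Sum>n\<in>A. \<integral>t. I m t * I n t \<partial>lborel) / s\<^sup>2
      - 2 * (\<Sum>n\<in>A. \<integral>t. I n t * \<phi> t \<partial>lborel) / s + (\<integral>t. (\<phi> t)\<^sup>2 \<partial>lborel)"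
    unfolding expand using int\<phi> intII sq by (simp add: Bochner_Integration.integral_sum)
  finally show ?thesis
    by (simp add: I_def set_lebesgue_integral_def integral_indicator_Icc_overlap)
qed

text \<open>The integer 0 competes with the nearest one. Overlaps, which are measured on the line,
  are therefore bounded by tents of the distance modulo 1 that \<open>pair_count\<close>
  uses.\<close>

lemma dist_nearest_int_le_abs: "dist_nearest_int y \<le> \<bar>y\<bar>"
  unfolding dist_nearest_int_def using round_diff_minimal[of y 0] by (simp add: abs_minus_commute)

lemma dist_nearest_int_nonneg: "0 \<le> dist_nearest_int y"
  by (simp add: dist_nearest_int_def)

lemma pair_count_eq_sum:
  "real (pair_count x s N) = (\<Sum>m\<in>{1..N}. \<Sum>n\<in>{1..N}.
     of_bool (m \<noteq> n \<and> dist_nearest_int (x m - x n) \<le> s / real N))"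
proof -
  have "{(m, n). m \<in> {1..N} \<and> n \<in> {1..N} \<and> m \<noteq> n \<and> dist_nearest_int (x m - x n) \<le> s / real N}
     = Sigma {1..N} (\<lambda>m. {n \<in> {1..N}. m \<noteq> n \<and> dist_nearest_int (x m - x n) \<le> s / real N})"
    by auto
  thus ?thesis
    by (simp add: pair_count_def of_bool_def sum.If_cases Int_def)
qed

lemma pair_count_mono: "s \<le> s' \<Longrightarrow> pair_count x s N \<le> pair_count x s' N"
proof -
  assume "s \<le> s'"
  hence "s / real N \<le> s' / real N" by (simp add: divide_right_mono)
  thus ?thesis unfolding pair_count_def
    by (intro card_mono) (auto intro: finite_subset[of _ "{1..N} \<times> {1..N}"])
qed

text \<open>Each of the N diagonal pairs contributes exactly h. For the others,
  \<open>card_multiples_ge\<close> applied to N times the distance modulo 1 bounds the tent by h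
  times an average of indicators; summed over all pairs, these give the pair counts.\<close>

lemma sum_overlap_le_pair_count:
  fixes x :: "nat \<Rightarrow> real"
  assumes "0 < \<delta>" "0 < K" "0 < N"
  defines "h \<equiv> real K * \<delta> / real N"
  shows "(\<Sum>m\<in>{1..N}. \<Sum>n\<in>{1..N}. max 0 (h - \<bar>x m - x n\<bar>))
    \<le> h * (real N + (\<Sum>k\<in>{1..K}. real (pair_count x (\<delta> * real k) N)) / real K)"
proof -
  have h: "0 < h" using assms by simp
  define p :: "nat \<Rightarrow> nat \<Rightarrow> nat \<Rightarrow> real" where
    "p k m n = of_bool (m \<noteq> n \<and> dist_nearest_int (x m - x n) \<le> \<delta> * real k / real N)" for k m n
  have "max 0 (h - \<bar>x m - x n\<bar>) \<le> h * (of_bool (m = n) + (\<Sum>k\<in>{1..K}. p k m n) / real K)" for m n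
  proof (cases "m = n")
    case True
    then show ?thesis using h by (simp add: p_def)
  next
    case False
    define D where "D = dist_nearest_int (x m - x n)"
    have D0: "0 \<le> D" by (simp add: D_def dist_nearest_int_nonneg)
    have "max 0 (h - \<bar>x m - x n\<bar>) \<le> max 0 (h - D)"
      using dist_nearest_int_le_abs[of "x m - x n"] by (auto simp: D_def)
    also have "max 0 (h - D) = h * max 0 (1 - real N * D / (real K * \<delta>))"
    proof -
      have "h - D = h * (1 - real N * D / (real K * \<delta>))"
        using assms(1-3) by (simp add: h_def field_simps)
      thus ?thesis using h by (simp add: max_mult_distrib_left)
    qed
    also have "\<dots> = h / real K * (real K * max 0 (1 - real N * D / (real K * \<delta>)))"
      using assms(2) by simp
    also have "\<dots> \<le> h / real K * real (card {k \<in> {1..K}. real N * D \<le> \<delta> * real k})"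
      using card_multiples_ge[of "real N * D" \<delta> K] D0 h assms by (intro mult_left_mono) auto
    also have "real (card {k \<in> {1..K}. real N * D \<le> \<delta> * real k}) = (\<Sum>k\<in>{1..K}. p k m n)"
      using False assms(3)
      by (simp add: p_def D_def[symmetric] pos_le_divide_eq mult.commute of_bool_def sum.If_cases Int_def)
    finally show ?thesis using False by simp
  qed
  hence "(\<Sum>m\<in>{1..N}. \<Sum>n\<in>{1..N}. max 0 (h - \<bar>x m - x n\<bar>))
    \<le> (\<Sum>m\<in>{1..N}. \<Sum>n\<in>{1..N}. h * (of_bool (m = n) + (\<Sum>k\<in>{1..K}. p k m n) / real K))"
    by (intro sum_mono)
  also have "\<dots> = h * ((\<Sum>m\<in>{1..N}. \<Sum>n\<in>{1..N}. of_bool (m = n))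
      + (\<Sum>m\<in>{1..N}. \<Sum>n\<in>{1..N}. \<Sum>k\<in>{1..K}. p k m n) / real K)"
    by (simp only: sum_distrib_left[symmetric] sum.distrib sum_divide_distrib[symmetric])
  also have "(\<Sum>m\<in>{1..N}. \<Sum>n\<in>{1..N}. of_bool (m = n)) = real N"
    by (simp add: of_bool_def)
  also have "(\<Sum>m\<in>{1..N}. \<Sum>n\<in>{1..N}. \<Sum>k\<in>{1..K}. p k m n)
      = (\<Sum>m\<in>{1..N}. \<Sum>k\<in>{1..K}. \<Sum>n\<in>{1..N}. p k m n)"
    by (rule sum.cong[OF refl], rule sum.swap)
  also have "\<dots> = (\<Sum>k\<in>{1..K}. \<Sum>m\<in>{1..N}. \<Sum>n\<in>{1..N}. p k m n)"
    by (rule sum.swap)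
  finally show ?thesis by (simp add: p_def pair_count_eq_sum)
qed

text \<open>The energy inequality and the overlap bound are combined at s = K \<delta>, h = s / N. A
  loss of at most \<epsilon> on the window left of each point lets the window average of \<phi> be
  replaced by \<open>\<phi> (x n) - \<epsilon>\<close>; the summand -1 comes from the diagonal
  pairs.\<close>

lemma pair_count_lower_bound:
  fixes x :: "nat \<Rightarrow> real" and \<phi> :: "real \<Rightarrow> real"
  assumes cont: "continuous_on UNIV \<phi>" and sq: "integrable lborel (\<lambda>t. (\<phi> t)\<^sup>2)"
    and pos: "0 < \<delta>" "0 < K" "0 < N"
    and lower: "\<And>n t. n \<in> {1..N} \<Longrightarrow> t \<in> {x n - real K * \<delta> / real N..x n} \<Longrightarrow> \<phi> (x n) - \<epsilon> \<le> \<phi> t"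
  shows "real K * \<delta> * (2 * ((\<Sum>n\<in>{1..N}. \<phi> (x n)) / real N - \<epsilon>) - (\<integral>t. (\<phi> t)\<^sup>2 \<partial>lborel)) - 1
    \<le> (\<Sum>k\<in>{1..K}. real (pair_count x (\<delta> * real k) N) / real N) / real K"
proof -
  define s h P J where "s = real K * \<delta>" and "h = s / real N"
    and "P = (\<Sum>k\<in>{1..K}. real (pair_count x (\<delta> * real k) N))"
    and "J = (\<integral>t. (\<phi> t)\<^sup>2 \<partial>lborel)"
  have s: "0 < s" and h: "0 < h" using pos by (auto simp: s_def h_def)
  have I: "h * (\<phi> (x n) - \<epsilon>) \<le> (LBINT t:{x n - h..x n}. \<phi> t)" if n: "n \<in> {1..N}" for n
  proof -
    have "h * (\<phi> (x n) - \<epsilon>) = (LBINT t:{x n - h..x n}. \<phi> (x n) - \<epsilon>)"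
      using h by (simp add: set_integral_const)
    also have "\<dots> \<le> (LBINT t:{x n - h..x n}. \<phi> t)"
    proof (rule set_integral_mono)
      show "set_integrable lborel {x n - h..x n} \<phi>"
        using continuous_on_subset[OF cont] by (intro borel_integrable_atLeastAtMost') auto
      show "set_integrable lborel {x n - h..x n} (\<lambda>t. \<phi> (x n) - \<epsilon>)"
        by (intro borel_integrable_atLeastAtMost') auto
    qed (use lower[OF n] in \<open>auto simp: h_def s_def\<close>)
    finally show ?thesis .
  qed
  have "2 * ((\<Sum>n\<in>{1..N}. \<phi> (x n)) / real N - \<epsilon>) = 2 * (\<Sum>n\<in>{1..N}. h * (\<phi> (x n) - \<epsilon>)) / s"
    unfolding sum_distrib_left[symmetric] sum_subtractf
    using s pos by (simp add: h_def field_simps)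
  also have "\<dots> \<le> 2 * (\<Sum>n\<in>{1..N}. LBINT t:{x n - h..x n}. \<phi> t) / s"
    using s I by (intro divide_right_mono mult_left_mono sum_mono) auto
  also have "\<dots> \<le> (\<Sum>m\<in>{1..N}. \<Sum>n\<in>{1..N}. max 0 (h - \<bar>x m - x n\<bar>)) / s\<^sup>2 + J"
    unfolding J_def by (rule energy_inequality[OF cont sq _ s]) simp
  also have "\<dots> \<le> h * (real N + P / real K) / s\<^sup>2 + J"
    using sum_overlap_le_pair_count[OF pos, of x]
    by (intro add_right_mono divide_right_mono) (auto simp: h_def s_def P_def)
  also have "h * (real N + P / real K) / s\<^sup>2 = (1 + P / real N / real K) / s"
    using s pos by (simp add: h_def field_simps power2_eq_square)
  finally have "s * (2 * ((\<Sum>n\<in>{1..N}. \<phi> (x n)) / real N - \<epsilon>) - J) \<le> 1 + P / real N / real K"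
    using s by (simp add: field_simps)
  thus ?thesis by (simp add: s_def J_def P_def sum_divide_distrib)
qed

section \<open>The limit distribution and weak convergence\<close>

locale asymptotic_distribution =
  fixes x :: "nat \<Rightarrow> real" and G :: "real \<Rightarrow> real"
  assumes x_range: "\<And>n. 1 \<le> n \<Longrightarrow> x n \<in> {0..1}"
    and G_lim: "\<And>t. t \<in> {0..1} \<Longrightarrow>
      (\<lambda>N. real (card {n \<in> {1..N}. x n \<in> {0..t}}) / real N) \<longlonglongrightarrow> G t"
begin

lemma G_mono: "0 \<le> t \<Longrightarrow> t \<le> u \<Longrightarrow> u \<le> 1 \<Longrightarrow> G t \<le> G u"
  by (rule LIMSEQ_le[OF G_lim G_lim])
     (auto intro!: exI[of _ 0] divide_right_mono card_mono)

lemma G_nonneg: "t \<in> {0..1} \<Longrightarrow> 0 \<le> G t"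
  by (rule LIMSEQ_le_const[OF G_lim]) auto

lemma G_1: "G 1 = 1"
proof (rule LIMSEQ_unique[OF G_lim])
  show "(\<lambda>N. real (card {n \<in> {1..N}. x n \<in> {0..1}}) / real N) \<longlonglongrightarrow> 1"
  proof (rule tendsto_eventually, rule eventually_mono[OF eventually_gt_at_top[of 0]])
    fix N :: nat assume "0 < N"
    moreover have "{n \<in> {1..N}. x n \<in> {0..1}} = {1..N}" using x_range by auto
    ultimately show "real (card {n \<in> {1..N}. x n \<in> {0..1}}) / real N = 1" by simp
  qed
qed simp

lemma bdd_below_G: "0 \<le> t \<Longrightarrow> bdd_below (G ` {t<..1})"
  using G_nonneg by (intro bdd_belowI[of _ 0]) auto

text \<open>With \<open>le_cdf_extension\<close> this sandwiches the right limit at t between G t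
  and any later value of G, which drives the comparisons below.\<close>

lemma cdf_extension_le: "0 \<le> t \<Longrightarrow> t < u \<Longrightarrow> u \<le> 1 \<Longrightarrow> cdf_extension G t \<le> G u"
  using bdd_below_G by (auto simp: cdf_extension_def intro!: cINF_lower)

lemma le_cdf_extension: "0 \<le> t \<Longrightarrow> t \<le> 1 \<Longrightarrow> G t \<le> cdf_extension G t"
  using G_mono by (auto simp: cdf_extension_def intro!: cINF_greatest)

lemma cdf_extension_mono: "t \<le> u \<Longrightarrow> cdf_extension G t \<le> cdf_extension G u"
proof -
  assume tu: "t \<le> u"
  consider "t = u" | "t < u" "t < 0" "u < 0" | "t < 0" "0 \<le> u" "u \<le> 1" | "t < 0" "1 < u"
    | "0 \<le> t" "t < u" "u \<le> 1" | "0 \<le> t" "t \<le> 1" "1 < u" | "1 < t"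
    using tu by linarith
  thus ?thesis
  proof cases
    case 3
    then show ?thesis using le_cdf_extension[of u] G_nonneg[of u] by (simp add: cdf_extension_def)
  next
    case 4
    then show ?thesis by (simp add: cdf_extension_def G_1)
  next
    case 5
    then show ?thesis using le_cdf_extension[of u] cdf_extension_le[of t u] by linarith
  next
    case 6
    then show ?thesis using cdf_extension_le[of t 1] by (auto simp: cdf_extension_def)
  qed (use tu in \<open>auto simp: cdf_extension_def\<close>)
qed

lemma cdf_extension_right_cont: "continuous (at_right a) (cdf_extension G)"
proof (subst continuous_at_right_real_increasing)
  show "\<forall>e>0. \<exists>d>0. cdf_extension G (a + d) - cdf_extension G a < e"
  proof (intro allI impI)
    fix e :: real assume e: "0 < e"
    consider "a < 0" | "0 \<le> a" "a < 1" | "1 \<le> a" by linarith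
    thus "\<exists>d>0. cdf_extension G (a + d) - cdf_extension G a < e"
    proof cases
      case 1
      then show ?thesis using e by (intro exI[of _ "-a/2"]) (auto simp: cdf_extension_def)
    next
      case 2
      hence "Inf (G ` {a<..1}) < cdf_extension G a + e" using e by (simp add: cdf_extension_def)
      then obtain y where y: "a < y" "y \<le> 1" "G y < cdf_extension G a + e"
        using 2 by (subst (asm) cInf_less_iff) (auto intro: bdd_below_G)
      \<comment> \<open>The midpoint lies strictly left of y; at y itself the right limit may exceed
        G y.\<close>
      have "cdf_extension G (a + (y - a) / 2) \<le> G y"
        using 2 y by (intro cdf_extension_le) (auto simp: field_simps)
      with y show ?thesis by (intro exI[of _ "(y - a) / 2"]) auto
    next
      case 3
      then show ?thesis using e by (intro exI[of _ 1]) (auto simp: cdf_extension_def)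
    qed
  qed
qed (rule cdf_extension_mono)

lemma cdf_extension_at_bot: "(cdf_extension G \<longlongrightarrow> 0) at_bot"
  by (rule tendsto_eventually) (auto simp: eventually_at_bot_dense cdf_extension_def)

lemma cdf_extension_at_top: "(cdf_extension G \<longlongrightarrow> 1) at_top"
  by (rule tendsto_eventually, rule eventually_mono[OF eventually_gt_at_top[of 1]])
     (simp add: cdf_extension_def G_1)

text \<open>Living on the whole line, this measure is open to the theory of weak convergence of real
  distributions; its restriction to [0,1] is \<open>cdf_measure G\<close>.\<close>

definition \<nu> :: "real measure" where "\<nu> = interval_measure (cdf_extension G)"

sublocale \<nu>: real_distribution \<nu>
  unfolding \<nu>_def
  by (intro real_distribution_interval_measure cdf_extension_mono cdf_extension_right_cont
      cdf_extension_at_bot cdf_extension_at_top)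

lemma cdf_\<nu>: "cdf \<nu> = cdf_extension G"
  unfolding \<nu>_def
  by (intro cdf_interval_measure cdf_extension_mono cdf_extension_right_cont cdf_extension_at_bot)

lemma AE_\<nu>_unit_interval: "AE t in \<nu>. t \<in> {0..1}"
proof -
  \<comment> \<open>The left limit of the distribution function at 0 is the mass of the open
    negative half-line; the point 0 may still carry mass.\<close>
  have "(cdf \<nu> \<longlongrightarrow> 0) (at_left 0)"
    unfolding cdf_\<nu> by (rule tendsto_eventually) (auto simp: eventually_at_filter cdf_extension_def)
  hence "measure \<nu> {..<0} = 0"
    using tendsto_unique[OF _ \<nu>.cdf_at_left] by fastforce
  hence "AE t in \<nu>. t \<notin> {..<0}"
    by (intro AE_not_in) (auto simp: null_sets_def \<nu>.emeasure_eq_measure)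
  moreover have "measure \<nu> {..1} = 1"
    using cdf_\<nu> by (simp add: cdf_def fun_eq_iff cdf_extension_def G_1)
  hence "AE t in \<nu>. t \<in> {..1}"
    by (subst (asm) \<nu>.prob_eq_1) auto
  ultimately show ?thesis by eventually_elim auto
qed

text \<open>The empirical measures converge weakly to \<nu>, because their distribution functions
  converge at every continuity point of the limit.\<close>

lemma average_tendsto_\<nu>:
  fixes \<phi> :: "real \<Rightarrow> real"
  assumes cont: "continuous_on UNIV \<phi>" and bdd: "\<And>t. \<bar>\<phi> t\<bar> \<le> B"
  shows "(\<lambda>N. (\<Sum>n\<in>{1..N}. \<phi> (x n)) / real N) \<longlonglongrightarrow> (\<integral>t. \<phi> t \<partial>\<nu>)"
proof -
  \<comment> \<open>Counting up to \<open>Suc N\<close> keeps the index set of the uniform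
    distribution nonempty; the shift is undone at the end.\<close>
  define E where "E N = distr (measure_pmf (pmf_of_set {1..Suc N})) borel x" for N
  have E: "real_distribution (E N)" for N
    unfolding E_def by (intro prob_space.real_distribution_distr measure_pmf.prob_space_axioms) simp
  have cdf_E: "cdf (E N) t = real (card {n \<in> {1..Suc N}. x n \<in> {..t}}) / real (Suc N)" for N t
    by (simp add: cdf_def E_def measure_distr measure_pmf_of_set vimage_def Int_def)
  have "weak_conv_m E \<nu>"
    unfolding weak_conv_m_def weak_conv_def
  proof (intro allI impI)
    fix t assume "isCont (cdf \<nu>) t"
    hence ct: "isCont (cdf_extension G) t" by (simp add: cdf_\<nu>)
    consider "t < 0" | "0 \<le> t" "t < 1" | "1 \<le> t" by linarith
    thus "(\<lambda>N. cdf (E N) t) \<longlonglongrightarrow> cdf \<nu> t"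
    proof cases
      case 1
      have "{n \<in> {1..Suc N}. x n \<in> {..t}} = {}" for N using x_range 1 by fastforce
      thus ?thesis unfolding cdf_E cdf_\<nu> by (simp only:) (use 1 in \<open>simp add: cdf_extension_def\<close>)
    next
      case 3
      have "{n \<in> {1..Suc N}. x n \<in> {..t}} = {1..Suc N}" for N using x_range 3 by fastforce
      thus ?thesis unfolding cdf_E cdf_\<nu> by (simp only:) (use 3 in \<open>simp add: cdf_extension_def G_1\<close>)
    next
      case 2
      \<comment> \<open>At jumps the extension may differ from G. At a continuity point its value is
        its left limit, which is at most G t, and \<open>le_cdf_extension\<close> gives
        equality.\<close>
      have "(cdf_extension G \<longlongrightarrow> cdf_extension G t) (at_left t)"
        using ct by (auto simp: isCont_def filterlim_at_split)
      moreover have "eventually (\<lambda>u. cdf_extension G u \<le> G t) (at_left t)"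
      proof (rule eventually_at_leftI[of "t - 1"])
        fix u assume "u \<in> {t - 1<..<t}"
        thus "cdf_extension G u \<le> G t"
          using 2 cdf_extension_le[of u t] G_nonneg[of t] by (cases "u < 0") (auto simp: cdf_extension_def)
      qed simp
      ultimately have "cdf_extension G t \<le> G t"
        by (rule tendsto_upperbound) simp
      hence eq: "cdf_extension G t = G t" using le_cdf_extension[of t] 2 by simp
      have "{n \<in> {1..Suc N}. x n \<in> {..t}} = {n \<in> {1..Suc N}. x n \<in> {0..t}}" for N
        using x_range by fastforce
      thus ?thesis unfolding cdf_E cdf_\<nu> eq by (simp only:) (use LIMSEQ_Suc[OF G_lim[of t]] 2 in simp)
    qed
  qed
  from weak_conv_imp_integral_bdd_continuous_conv[OF E \<nu>.real_distribution_axioms this, of \<phi> B]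
  have "(\<lambda>N. \<integral>t. \<phi> t \<partial>E N) \<longlonglongrightarrow> (\<integral>t. \<phi> t \<partial>\<nu>)"
    using cont bdd by (simp add: continuous_on_eq_continuous_at)
  moreover have "(\<integral>t. \<phi> t \<partial>E N) = (\<Sum>n\<in>{1..Suc N}. \<phi> (x n)) / real (Suc N)" for N
  proof -
    have [measurable]: "\<phi> \<in> borel_measurable borel" by (rule borel_measurable_continuous_onI[OF cont])
    show ?thesis unfolding E_def
      by (subst integral_distr) (simp_all add: integral_pmf_of_set del: of_nat_Suc)
  qed
  ultimately have "(\<lambda>N. (\<Sum>n\<in>{1..Suc N}. \<phi> (x n)) / real (Suc N)) \<longlonglongrightarrow> (\<integral>t. \<phi> t \<partial>\<nu>)"
    by (simp only:)
  thus ?thesis by (rule LIMSEQ_imp_Suc)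
qed

end

section \<open>Lower bounds for sums of pair correlations\<close>

locale pair_correlation = asymptotic_distribution +
  fixes F :: "real \<Rightarrow> ennreal"
  assumes F_lim: "\<And>s. 0 < s \<Longrightarrow>
      (\<lambda>N. ennreal (real (pair_count x s N) / real N)) \<longlonglongrightarrow> F s"
begin

lemma F_mono:
  assumes "0 < s" "s \<le> s'"
  shows "F s \<le> F s'"
proof (rule LIMSEQ_le[OF F_lim F_lim])
  show "\<exists>n0. \<forall>N\<ge>n0. ennreal (real (pair_count x s N) / real N) \<le> ennreal (real (pair_count x s' N) / real N)"
    using pair_count_mono[OF assms(2)] by (intro exI allI impI ennreal_leI divide_right_mono) auto
qed (use assms in auto)

text \<open>If \<nu> has a square-integrable density g, this is the integral of g^2 minus that of (g
  - \<phi>)^2, so \<phi> = g is the best choice.\<close>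

definition quad :: "(real \<Rightarrow> real) \<Rightarrow> real" where
  "quad \<phi> = 2 * (\<integral>t. \<phi> t \<partial>\<nu>) - (\<integral>t. (\<phi> t)\<^sup>2 \<partial>lborel)"

text \<open>The bound of \<open>pair_count_lower_bound\<close>, multiplied by K, is passed to the
  limit, first in N with \<epsilon> fixed and then in \<epsilon>. The conversion
  \<open>ennreal\<close> is continuous and sends negative values to 0, so the sign of the bound does
  not matter.\<close>

lemma sum_F_lower_bound:
  fixes \<phi> :: "real \<Rightarrow> real"
  assumes cont: "continuous_on UNIV \<phi>" and bdd: "\<And>t. \<bar>\<phi> t\<bar> \<le> B"
    and sq: "integrable lborel (\<lambda>t. (\<phi> t)\<^sup>2)" and pos: "0 < \<delta>" "0 < K"
  shows "ennreal (real K * (real K * \<delta> * quad \<phi> - 1)) \<le> (\<Sum>k\<in>{1..K}. F (\<delta> * real k))"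
proof -
  define J where "J = (\<integral>t. (\<phi> t)\<^sup>2 \<partial>lborel)"
  define b where "b A \<epsilon> = real K * (real K * \<delta> * (2 * (A - \<epsilon>) - J) - 1)" for A \<epsilon>
  have lower: "ennreal (b (\<integral>t. \<phi> t \<partial>\<nu>) \<epsilon>) \<le> (\<Sum>k\<in>{1..K}. F (\<delta> * real k))" if \<epsilon>: "0 < \<epsilon>" for \<epsilon>
  proof -
    \<comment> \<open>For large N the windows have length below 1; ending at points of [0,1], they
      stay inside [-1,1].\<close>
    have "uniformly_continuous_on {-1..1} \<phi>"
      using cont by (intro compact_uniformly_continuous) (auto intro: continuous_on_subset)
    then obtain d where d: "0 < d"
      "\<And>t t'. t \<in> {-1..1} \<Longrightarrow> t' \<in> {-1..1} \<Longrightarrow> dist t' t < d \<Longrightarrow> dist (\<phi> t') (\<phi> t) < \<epsilon>"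
      using \<epsilon> unfolding uniformly_continuous_on_def by metis
    have "((\<lambda>N. real K * \<delta> / real N) \<longlonglongrightarrow> 0)" by real_asymp
    hence "eventually (\<lambda>N. real K * \<delta> / real N < min d 1) sequentially"
      using d(1) by (intro order_tendstoD) auto
    hence "eventually (\<lambda>N. ennreal (b ((\<Sum>n\<in>{1..N}. \<phi> (x n)) / real N) \<epsilon>)
        \<le> (\<Sum>k\<in>{1..K}. ennreal (real (pair_count x (\<delta> * real k) N) / real N))) sequentially"
      using eventually_gt_at_top[of 0]
    proof eventually_elim
      case (elim N)
      have "\<phi> (x n) - \<epsilon> \<le> \<phi> t" if "n \<in> {1..N}" "t \<in> {x n - real K * \<delta> / real N..x n}" for n t
      proof -
        have xn: "0 \<le> x n" "x n \<le> 1" using x_range[of n] that(1) by auto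
        have h: "real K * \<delta> / real N < d" "real K * \<delta> / real N < 1" using elim by auto
        have t: "x n - real K * \<delta> / real N \<le> t" "t \<le> x n" using that(2) by auto
        have "-1 \<le> t" "t \<le> 1" "\<bar>t - x n\<bar> < d" using xn h t by linarith+
        hence "dist (\<phi> t) (\<phi> (x n)) < \<epsilon>"
          using xn by (intro d(2)) (auto simp: dist_real_def)
        thus ?thesis by (simp add: dist_real_def)
      qed
      from pair_count_lower_bound[OF cont sq pos \<open>0 < N\<close> this]
      have "b ((\<Sum>n\<in>{1..N}. \<phi> (x n)) / real N) \<epsilon>
          \<le> (\<Sum>k\<in>{1..K}. real (pair_count x (\<delta> * real k) N) / real N)"
        using pos(2) by (simp add: b_def J_def field_simps)
      thus ?case by (simp add: ennreal_leI)
    qed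
    moreover have "(\<lambda>N. ennreal (b ((\<Sum>n\<in>{1..N}. \<phi> (x n)) / real N) \<epsilon>)) \<longlonglongrightarrow> ennreal (b (\<integral>t. \<phi> t \<partial>\<nu>) \<epsilon>)"
      unfolding b_def by (intro tendsto_intros tendsto_ennrealI average_tendsto_\<nu>[OF cont bdd])
    moreover have "(\<lambda>N. \<Sum>k\<in>{1..K}. ennreal (real (pair_count x (\<delta> * real k) N) / real N))
        \<longlonglongrightarrow> (\<Sum>k\<in>{1..K}. F (\<delta> * real k))"
      using pos by (intro tendsto_sum F_lim) auto
    ultimately show ?thesis
      by (intro tendsto_le[OF sequentially_bot])
  qed
  have "(\<lambda>j. b (\<integral>t. \<phi> t \<partial>\<nu>) (inverse (real (Suc j)))) \<longlonglongrightarrow> b (\<integral>t. \<phi> t \<partial>\<nu>) 0"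
    unfolding b_def by (intro tendsto_intros LIMSEQ_inverse_real_of_nat)
  hence "(\<lambda>j. ennreal (b (\<integral>t. \<phi> t \<partial>\<nu>) (inverse (real (Suc j))))) \<longlonglongrightarrow> ennreal (b (\<integral>t. \<phi> t \<partial>\<nu>) 0)"
    by (rule tendsto_ennrealI)
  hence "ennreal (b (\<integral>t. \<phi> t \<partial>\<nu>) 0) \<le> (\<Sum>k\<in>{1..K}. F (\<delta> * real k))"
    by (rule LIMSEQ_le_const2) (intro exI allI impI lower, simp)
  thus ?thesis by (simp add: b_def quad_def J_def)
qed

section \<open>Limit distributions that are not absolutely continuous\<close>

text \<open>If F s were a finite r, the case K = 1, \<delta> = s of \<open>sum_F_lower_bound\<close>
  would bound s * quad \<phi> - 1 by r for every admissible \<phi>. Concentrating \<phi> near a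
  compact null set of positive \<nu>-mass violates this.\<close>

lemma F_eq_infinity:
  assumes "\<not> abs_cont_cdf G" "0 < s"
  shows "F s = \<infinity>"
proof (rule ccontr)
  assume "F s \<noteq> \<infinity>"
  then obtain r where r: "F s = ennreal r" "0 \<le> r" by (cases "F s") auto
  from assms(1) obtain A where A: "A \<in> null_sets unit_lebesgue" "A \<notin> null_sets (cdf_measure G)"
    by (auto simp: abs_cont_cdf_def absolutely_continuous_def)
  hence A': "A \<subseteq> {0..1}" "A \<in> null_sets lborel" "A \<notin> null_sets \<nu>"
    by (auto simp: null_sets_restrict_space cdf_measure_def \<nu>_def)
  hence A_borel: "A \<in> sets borel" by auto
  with A'(3) have "0 < emeasure \<nu> A" by (auto simp: null_sets_def zero_less_iff_neq_zero)
  \<comment> \<open>The functions \<open>\<psi> j\<close> below converge to the indicator of a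
    closed set, so A is replaced by a compact subset that still has positive mass.\<close>
  also have "emeasure \<nu> A = (SUP K \<in> {K. K \<subseteq> A \<and> compact K}. emeasure \<nu> K)"
    using A_borel by (intro inner_regular) auto
  finally obtain C where C: "C \<subseteq> A" "compact C" "0 < emeasure \<nu> C"
    by (auto simp: less_SUP_iff)
  define m where "m = measure \<nu> C"
  have m: "0 < m" using C(3) by (simp add: m_def \<nu>.emeasure_eq_measure)
  have Cne: "C \<noteq> {}" using C(3) by auto
  have C_closed: "closed C" using C(2) by (rule compact_imp_closed)
  have C_borel: "C \<in> sets borel" using C_closed by simp
  have C_null: "C \<in> null_sets lborel" using A'(2) C(1) C_borel by (auto intro: null_sets_subset)
  define \<psi> where "\<psi> j t = max 0 (1 - real (Suc j) * infdist t C)" for j t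
  have \<psi>_cont: "continuous_on UNIV (\<psi> j)" for j
    unfolding \<psi>_def by (intro continuous_intros)
  have [measurable]: "\<psi> j \<in> borel_measurable borel" for j
    by (rule borel_measurable_continuous_onI[OF \<psi>_cont])
  have \<psi>01: "0 \<le> \<psi> j t" "\<psi> j t \<le> 1" for j t
    by (auto simp: \<psi>_def infdist_nonneg)
  have \<psi>_ge: "indicator C t \<le> \<psi> j t" for j t
    using \<psi>01 by (auto simp: \<psi>_def indicator_def)
  \<comment> \<open>Outside [-1,2] the distance to C, a subset of [0,1], is at least 1, so every
    \<open>\<psi> j\<close> vanishes there. This common support gives integrability and
    domination.\<close>
  have \<psi>_dom: "(\<psi> j t)\<^sup>2 \<le> indicator {-1..2} t" for j t
  proof (cases "t \<in> {-1..2}")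
    case True
    thus ?thesis using \<psi>01[of j t] by (simp add: power_le_one)
  next
    case False
    have "1 \<le> infdist t C"
      unfolding infdist_notempty[OF Cne]
    proof (rule cINF_greatest[OF Cne])
      fix c assume "c \<in> C"
      hence "c \<in> {0..1}" using C(1) A'(1) by blast
      thus "1 \<le> dist t c" using False by (auto simp: dist_real_def)
    qed
    hence "1 * 1 \<le> real (Suc j) * infdist t C" by (intro mult_mono) auto
    thus ?thesis using False by (simp add: \<psi>_def)
  qed
  have \<psi>_int: "integrable lborel (\<lambda>t. (\<psi> j t)\<^sup>2)" for j
    by (rule Bochner_Integration.integrable_bound[of _ "indicator {-1..2} :: real \<Rightarrow> real"])
       (use \<psi>_dom in auto)
  have "(\<lambda>j. \<integral>t. (\<psi> j t)\<^sup>2 \<partial>lborel) \<longlonglongrightarrow> (\<integral>t. 0 \<partial>(lborel :: real measure))"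
  proof (rule integral_dominated_convergence[where w = "indicator {-1..2}"])
    have "AE t in lborel. t \<notin> C" by (rule AE_not_in[OF C_null])
    thus "AE t in lborel. (\<lambda>j. (\<psi> j t)\<^sup>2) \<longlonglongrightarrow> 0"
    proof eventually_elim
      case (elim t)
      hence "0 < infdist t C"
        using infdist_pos_not_in_closed[OF C_closed Cne] by simp
      then obtain n where "1 < real n * infdist t C"
        using ex_less_of_nat_mult by blast
      have "(\<psi> j t)\<^sup>2 = 0" if "j \<ge> n" for j
      proof -
        have "real n * infdist t C \<le> real (Suc j) * infdist t C"
          using that by (intro mult_right_mono) (auto simp: infdist_nonneg)
        with \<open>1 < _\<close> show ?thesis by (simp add: \<psi>_def)
      qed
      thus ?case by (intro tendsto_eventually) (auto simp: eventually_sequentially)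
    qed
  qed (use \<psi>_dom in auto)
  hence lim: "(\<lambda>j. \<integral>t. (\<psi> j t)\<^sup>2 \<partial>lborel) \<longlonglongrightarrow> 0" by simp
  \<comment> \<open>This makes the linear term of s * quad at least 2 s a m = 2 (r + 2). Then j is
    taken so large that the quadratic term stays below r + 2, and subtracting 1 still leaves more
    than r + 1.\<close>
  define a where "a = (r + 2) / (s * m)"
  have a: "0 < a" using r assms m by (simp add: a_def)
  have "eventually (\<lambda>j. (\<integral>t. (\<psi> j t)\<^sup>2 \<partial>lborel) < (r + 2) / (s * a\<^sup>2)) sequentially"
    using r assms a by (intro order_tendstoD(2)[OF lim]) auto
  then obtain j where "(\<integral>t. (\<psi> j t)\<^sup>2 \<partial>lborel) < (r + 2) / (s * a\<^sup>2)"
    using eventually_happens by force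
  hence j: "s * (a\<^sup>2 * (\<integral>t. (\<psi> j t)\<^sup>2 \<partial>lborel)) < r + 2"
    using assms a by (simp add: field_simps)
  have "m = (\<integral>t. indicator C t \<partial>\<nu>)" using C_borel by (simp add: m_def)
  also have "\<dots> \<le> (\<integral>t. \<psi> j t \<partial>\<nu>)"
  proof (rule integral_mono)
    show "integrable \<nu> (\<psi> j)"
      by (rule \<nu>.integrable_const_bound[of _ 1]) (use \<psi>01 in auto)
    show "integrable \<nu> (indicator C :: real \<Rightarrow> real)"
      by (rule \<nu>.integrable_const_bound[of _ 1]) (use C_borel in auto)
  qed (rule \<psi>_ge)
  finally have "2 * (s * (a * m)) \<le> 2 * (s * (a * (\<integral>t. \<psi> j t \<partial>\<nu>)))"
    using a assms by (intro mult_left_mono) auto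
  moreover have "s * (a * m) = r + 2" using m assms by (simp add: a_def)
  ultimately have "r + 1 < s * quad (\<lambda>t. a * \<psi> j t) - 1"
    using j r(2) by (simp add: quad_def algebra_simps)
  moreover have "ennreal (s * quad (\<lambda>t. a * \<psi> j t) - 1) \<le> F s"
  proof -
    have "ennreal (real 1 * (real 1 * s * quad (\<lambda>t. a * \<psi> j t) - 1)) \<le> (\<Sum>k\<in>{1..1}. F (s * real k))"
    proof (rule sum_F_lower_bound)
      show "continuous_on UNIV (\<lambda>t. a * \<psi> j t)" by (intro continuous_intros \<psi>_cont)
      show "\<bar>a * \<psi> j t\<bar> \<le> a" for t
        using \<psi>01[of j t] a by (simp add: abs_mult mult_left_le)
      show "integrable lborel (\<lambda>t. (a * \<psi> j t)\<^sup>2)"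
        using \<psi>_int by (simp add: power_mult_distrib)
    qed (use assms in auto)
    thus ?thesis by simp
  qed
  ultimately show False using r by simp
qed

section \<open>The upper limit and the square integral of the density\<close>

text \<open>If the upper limit were below some c < quad \<phi>, then F s would be at most 2 c s for
  large s. With \<delta> = 1 the sum of F over 1, ..., K would be at most c K^2 + O(K), against the
  lower bound K^2 * quad \<phi> - K.\<close>

lemma quad_le_Limsup:
  fixes \<phi> :: "real \<Rightarrow> real"
  assumes cont: "continuous_on UNIV \<phi>" and bdd: "\<And>t. \<bar>\<phi> t\<bar> \<le> B"
    and sq: "integrable lborel (\<lambda>t. (\<phi> t)\<^sup>2)"
  shows "ennreal (quad \<phi>) \<le> Limsup at_top (\<lambda>s. F s / ennreal (2 * s))"
proof (rule ccontr)
  assume "\<not> ?thesis"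
  then obtain c' where c': "Limsup at_top (\<lambda>s. F s / ennreal (2 * s)) < c'" "c' < ennreal (quad \<phi>)"
    using dense by (metis not_le)
  then obtain c where c: "c' = ennreal c" "0 \<le> c" by (cases c') auto
  have cQ: "c < quad \<phi>" using c' c by (simp add: ennreal_less_iff)
  have "eventually (\<lambda>s. F s / ennreal (2 * s) < ennreal c) at_top"
    using c' c by (intro Limsup_lessD) auto
  then obtain s0 where s0: "\<And>s. s \<ge> s0 \<Longrightarrow> F s / ennreal (2 * s) < ennreal c"
    by (auto simp: eventually_at_top_linorder)
  define S where "S = max 1 s0"
  have S: "0 < S" by (simp add: S_def)
  have F_le: "F s \<le> ennreal (2 * c * s)" if "S \<le> s" for s
  proof -
    have s: "0 < s" "s0 \<le> s" using that by (auto simp: S_def)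
    have "F s = F s / ennreal (2 * s) * ennreal (2 * s)"
      using s by (simp add: ennreal_divide_times ennreal_mult_divide_eq)
    also have "\<dots> \<le> ennreal c * ennreal (2 * s)"
      using s0[OF s(2)] by (intro mult_right_mono) auto
    finally show ?thesis using c(2) s by (simp add: ennreal_mult[symmetric] mult_ac)
  qed
  \<comment> \<open>The summand 2 c S covers the k below S, where F k \<le> F S by monotonicity. The
    factor 1 is the \<delta> of \<open>sum_F_lower_bound\<close>.\<close>
  have F_le': "F (1 * real k) \<le> ennreal (2 * c * S + 2 * c * real k)" if "1 \<le> k" for k
  proof (cases "S \<le> real k")
    case True
    have "F (real k) \<le> ennreal (2 * c * real k)" by (rule F_le[OF True])
    also have "\<dots> \<le> ennreal (2 * c * S + 2 * c * real k)" using c S by (intro ennreal_leI) simp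
    finally show ?thesis by simp
  next
    case False
    have "F (real k) \<le> F S" using False that by (intro F_mono) auto
    also have "\<dots> \<le> ennreal (2 * c * S)" by (rule F_le) simp
    also have "\<dots> \<le> ennreal (2 * c * S + 2 * c * real k)" using c by (intro ennreal_leI) simp
    finally show ?thesis by simp
  qed
  \<comment> \<open>The condition says that K * quad \<phi> - 1 exceeds 2 c S + c (K + 1), which are
    the two bounds after division by K.\<close>
  obtain K where K: "0 < K" "1 + 2 * c * S + c < real K * (quad \<phi> - c)"
  proof -
    obtain n where n: "1 + 2 * c * S + c < real n * (quad \<phi> - c)"
      using ex_less_of_nat_mult[of "quad \<phi> - c"] cQ by auto
    moreover have "0 < 1 + 2 * c * S + c" using c S by (simp add: add_pos_nonneg)
    ultimately have "n \<noteq> 0" by (intro notI) simp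
    with n show thesis by (intro that) auto
  qed
  have gauss: "(\<Sum>k\<in>{1..K}. real k) = real K * (real K + 1) / 2"
    using double_gauss_sum_from_Suc_0[of K, where 'a = real] by simp
  have "ennreal (real K * (real K * 1 * quad \<phi> - 1)) \<le> (\<Sum>k\<in>{1..K}. F (1 * real k))"
    by (rule sum_F_lower_bound[OF cont bdd sq _ K(1)]) simp
  also have "\<dots> \<le> (\<Sum>k\<in>{1..K}. ennreal (2 * c * S + 2 * c * real k))"
    by (intro sum_mono F_le') auto
  also have "\<dots> = ennreal (\<Sum>k\<in>{1..K}. 2 * c * S + 2 * c * real k)"
    using c S by (intro sum_ennreal) auto
  also have "(\<Sum>k\<in>{1..K}. 2 * c * S + 2 * c * real k) = real K * (2 * c * S + c * (real K + 1))"
    unfolding sum.distrib sum_distrib_left[symmetric] gauss by (simp add: algebra_simps)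
  finally have "real K * (real K * 1 * quad \<phi> - 1) \<le> real K * (2 * c * S + c * (real K + 1))"
    using c S by (subst (asm) ennreal_le_iff) auto
  hence "real K * quad \<phi> - 1 \<le> 2 * c * S + c * (real K + 1)"
    using K(1) by simp
  thus False using K(2) by (simp add: algebra_simps)
qed

text \<open>The density may be unbounded and its square not integrable, so the truncations f = min r
  M come first. Along continuous approximations of f, \<open>quad\<close> tends to 2 \<integral>r f
  - \<integral>f^2, which is at least \<integral>f^2 because 0 \<le> f \<le> r on [0,1].\<close>

lemma integral_density_le_Limsup:
  assumes g: "is_density_of g G"
  shows "(\<integral>\<^sup>+t. (g t)\<^sup>2 \<partial>unit_lebesgue) \<le> Limsup at_top (\<lambda>s. F s / ennreal (2 * s))"
proof -
  let ?U = unit_lebesgue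
  \<comment> \<open>Total mass 1 forces g to be finite almost everywhere, so r, with value 0 where g
    is infinite, is a density of the same measure.\<close>
  define r where "r t = enn2real (g t)" for t
  have g_meas[measurable]: "g \<in> borel_measurable ?U"
    and g_eq: "density ?U g = cdf_measure G"
    using g by (auto simp: is_density_of_def)
  have r_meas[measurable]: "r \<in> borel_measurable ?U" unfolding r_def by measurable
  have r_nonneg: "0 \<le> r t" for t by (simp add: r_def)
  have "emeasure \<nu> {0..1} = 1"
    using AE_\<nu>_unit_interval by (intro \<nu>.emeasure_eq_1_AE) auto
  hence "emeasure (density ?U g) {0..1} = 1"
    unfolding g_eq cdf_measure_def \<nu>_def[symmetric] by (subst emeasure_restrict_space) auto
  moreover have "emeasure (density ?U g) {0..1} = (\<integral>\<^sup>+t. g t \<partial>?U)"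
    by (subst emeasure_density) (auto simp: sets_restrict_space space_restrict_space intro!: nn_integral_cong)
  ultimately have g_total: "(\<integral>\<^sup>+t. g t \<partial>?U) = 1" by simp
  hence "AE t in ?U. g t \<noteq> \<infinity>"
    by (intro nn_integral_PInf_AE) auto
  hence g_r: "AE t in ?U. g t = ennreal (r t)"
    by eventually_elim (simp add: r_def less_top)
  have r_int: "integrable ?U r"
  proof (rule integrableI_nonneg)
    have "(\<integral>\<^sup>+t. ennreal (r t) \<partial>?U) = (\<integral>\<^sup>+t. g t \<partial>?U)"
      using g_r by (intro nn_integral_cong_AE) auto
    thus "(\<integral>\<^sup>+t. ennreal (r t) \<partial>?U) < \<infinity>" by (simp add: g_total)
  qed (auto simp: r_nonneg)
  have integral_\<nu>: "(\<integral>t. \<phi> t \<partial>\<nu>) = (\<integral>t. r t * \<phi> t \<partial>?U)"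
    if cont: "continuous_on UNIV \<phi>" for \<phi> :: "real \<Rightarrow> real"
  proof -
    have [measurable]: "\<phi> \<in> borel_measurable borel" by (rule borel_measurable_continuous_onI[OF cont])
    have \<phi>U: "\<phi> \<in> borel_measurable ?U" by (intro measurable_restrict_space1) simp
    have "(\<integral>t. \<phi> t \<partial>\<nu>) = (\<integral>t. indicator {0..1} t *\<^sub>R \<phi> t \<partial>\<nu>)"
      using AE_\<nu>_unit_interval by (intro integral_cong_AE) auto
    also have "\<dots> = (\<integral>t. \<phi> t \<partial>cdf_measure G)"
      unfolding cdf_measure_def \<nu>_def[symmetric] by (subst integral_restrict_space) auto
    also have "cdf_measure G = density ?U (\<lambda>t. ennreal (r t))"
      unfolding g_eq[symmetric] using g_r by (intro density_cong) auto
    also have "(\<integral>t. \<phi> t \<partial>density ?U (\<lambda>t. ennreal (r t))) = (\<integral>t. r t * \<phi> t \<partial>?U)"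
      using \<phi>U r_nonneg by (subst integral_density) auto
    finally show ?thesis .
  qed

  have trunc: "(\<integral>\<^sup>+t. ennreal ((min (r t) M)\<^sup>2) \<partial>?U) \<le> Limsup at_top (\<lambda>s. F s / ennreal (2 * s))"
    if M: "0 \<le> M" for M
  proof -
    define f where "f t = (if t \<in> {0..1} then min (r t) M else 0)" for t
    have f_eq: "f = (\<lambda>t. indicator {0..1} t *\<^sub>R min (r t) M)" by (auto simp: f_def fun_eq_iff)
    have "(\<lambda>t. min (r t) M) \<in> borel_measurable ?U" by measurable
    hence f_meas[measurable]: "f \<in> borel_measurable borel"
      unfolding f_eq by (subst (asm) borel_measurable_restrict_space_iff) auto
    have f_bound: "0 \<le> f t" "f t \<le> M" for t using r_nonneg M by (auto simp: f_def)
    \<comment> \<open>Unfolding this notion yields continuous functions \<open>u n\<close> that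
      converge to f outside a negligible set.\<close>
    have "f measurable_on UNIV"
      using measurable_completion[of f lborel borel] f_meas
      by (simp add: measurable_on_iff_borel_measurable)
    then obtain Z u where Z: "negligible Z" and u_cont: "\<And>n::nat. continuous_on UNIV (u n)"
      and u_lim: "\<And>t. t \<notin> Z \<Longrightarrow> (\<lambda>n. u n t) \<longlonglongrightarrow> f t"
      unfolding measurable_on_def by auto
    \<comment> \<open>A continuous cutoff, 1 on [0,1] and 0 outside [-1,2]. With the clamping to
      [0,M] it bounds all \<open>\<phi> n\<close> and their squares uniformly and leaves the limit f
      unchanged.\<close>
    define \<kappa> :: "real \<Rightarrow> real" where "\<kappa> t = max 0 (min 1 (min (t + 1) (2 - t)))" for t
    define \<phi> where "\<phi> n t = min M (max 0 (u n t)) * \<kappa> t" for n t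
    have \<phi>_cont: "continuous_on UNIV (\<phi> n)" for n
      unfolding \<phi>_def \<kappa>_def by (intro continuous_intros u_cont)
    have [measurable]: "\<phi> n \<in> borel_measurable borel" for n
      by (rule borel_measurable_continuous_onI[OF \<phi>_cont])
    have \<phi>U[measurable]: "\<phi> n \<in> borel_measurable ?U" for n by (intro measurable_restrict_space1) simp
    have \<kappa>: "0 \<le> \<kappa> t" "\<kappa> t \<le> indicator {-1..2} t" for t
      by (auto simp: \<kappa>_def indicator_def)
    have \<phi>_nonneg: "0 \<le> \<phi> n t" for n t using M \<kappa>(1) by (simp add: \<phi>_def)
    have \<phi>_dom: "\<phi> n t \<le> M * indicator {-1..2} t" for n t
      unfolding \<phi>_def using M \<kappa> by (intro mult_mono) auto
    have \<phi>_le: "\<phi> n t \<le> M" for n t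
      using \<phi>_dom[of n t] M by (cases "t \<in> {-1..2}") auto
    have \<phi>2_dom: "(\<phi> n t)\<^sup>2 \<le> M\<^sup>2 * indicator {-1..2} t" for n t
      using power_mono[OF \<phi>_dom \<phi>_nonneg, of n t 2] by (cases "t \<in> {-1..2}") auto
    have \<phi>_sq: "integrable lborel (\<lambda>t. (\<phi> n t)\<^sup>2)" for n
      by (rule Bochner_Integration.integrable_bound[of _ "\<lambda>t. M\<^sup>2 * indicator {-1..2} t"])
         (use \<phi>2_dom in auto)
    have "AE t in lebesgue. t \<notin> Z"
      using Z by (intro AE_not_in) (simp add: negligible_iff_null_sets)
    hence "AE t in lborel. t \<notin> Z" by (simp add: AE_completion_iff)
    hence \<phi>_lim: "AE t in lborel. (\<lambda>n. \<phi> n t) \<longlonglongrightarrow> f t"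
    proof eventually_elim
      case (elim t)
      have "(\<lambda>n. \<phi> n t) \<longlonglongrightarrow> min M (max 0 (f t)) * \<kappa> t"
        unfolding \<phi>_def by (intro tendsto_intros u_lim elim)
      moreover have "min M (max 0 (f t)) * \<kappa> t = f t"
        using f_bound[of t] by (auto simp: f_def \<kappa>_def)
      ultimately show ?case by simp
    qed
    have "(\<lambda>n. \<integral>t. (\<phi> n t)\<^sup>2 \<partial>lborel) \<longlonglongrightarrow> (\<integral>t. (f t)\<^sup>2 \<partial>lborel)"
    proof (rule integral_dominated_convergence[where w = "\<lambda>t. M\<^sup>2 * indicator {-1..2} t"])
      show "AE t in lborel. (\<lambda>n. (\<phi> n t)\<^sup>2) \<longlonglongrightarrow> (f t)\<^sup>2"
        using \<phi>_lim by eventually_elim (intro tendsto_intros)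
    qed (use \<phi>2_dom in auto)
    \<comment> \<open>The dominating function is r M, since r is integrable while r^2 might not
      be.\<close>
    moreover have "(\<lambda>n. \<integral>t. r t * \<phi> n t \<partial>?U) \<longlonglongrightarrow> (\<integral>t. r t * f t \<partial>?U)"
    proof (rule integral_dominated_convergence[where w = "\<lambda>t. r t * M"])
      have "AE t in ?U. (\<lambda>n. \<phi> n t) \<longlonglongrightarrow> f t"
        using \<phi>_lim by (subst AE_restrict_space_iff) (auto elim: eventually_mono)
      thus "AE t in ?U. (\<lambda>n. r t * \<phi> n t) \<longlonglongrightarrow> r t * f t"
        by eventually_elim (intro tendsto_intros)
      show "integrable ?U (\<lambda>t. r t * M)" using r_int by simp
      show "AE t in ?U. norm (r t * \<phi> n t) \<le> r t * M" for n
        using \<phi>_le \<phi>_nonneg r_nonneg by (intro AE_I2) (auto simp: abs_mult intro!: mult_left_mono)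
      show "(\<lambda>t. r t * f t) \<in> borel_measurable ?U"
        using measurable_restrict_space1[OF f_meas] by measurable
    qed auto
    ultimately have "(\<lambda>n. quad (\<phi> n)) \<longlonglongrightarrow> 2 * (\<integral>t. r t * f t \<partial>?U) - (\<integral>t. (f t)\<^sup>2 \<partial>lborel)"
      unfolding quad_def integral_\<nu>[OF \<phi>_cont] by (intro tendsto_intros)
    hence "(\<lambda>n. ennreal (quad (\<phi> n))) \<longlonglongrightarrow> ennreal (2 * (\<integral>t. r t * f t \<partial>?U) - (\<integral>t. (f t)\<^sup>2 \<partial>lborel))"
      by (rule tendsto_ennrealI)
    moreover have "ennreal (quad (\<phi> n)) \<le> Limsup at_top (\<lambda>s. F s / ennreal (2 * s))" for n
      by (rule quad_le_Limsup[OF \<phi>_cont _ \<phi>_sq, of n M]) (use \<phi>_le \<phi>_nonneg in \<open>simp add: abs_le_iff\<close>)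
    ultimately have "ennreal (2 * (\<integral>t. r t * f t \<partial>?U) - (\<integral>t. (f t)\<^sup>2 \<partial>lborel))
        \<le> Limsup at_top (\<lambda>s. F s / ennreal (2 * s))"
      by (intro LIMSEQ_le_const2) auto
    moreover have "(\<integral>t. (f t)\<^sup>2 \<partial>lborel) = (\<integral>t. (min (r t) M)\<^sup>2 \<partial>?U)"
      by (subst integral_restrict_space)
         (auto simp: f_def indicator_def intro!: Bochner_Integration.integral_cong)
    moreover have "(\<integral>t. (min (r t) M)\<^sup>2 \<partial>?U) \<le> (\<integral>t. r t * f t \<partial>?U)"
    proof (rule integral_mono_AE)
      have dom: "integrable ?U (\<lambda>t. r t * M)" using r_int by simp
      show "integrable ?U (\<lambda>t. r t * f t)"
        by (rule Bochner_Integration.integrable_bound[OF dom])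
           (use f_bound r_nonneg M measurable_restrict_space1[OF f_meas] in
             \<open>auto simp: abs_mult intro!: mult_left_mono\<close>)
      have le: "(min (r t) M)\<^sup>2 \<le> r t * min (r t) M" "min (r t) M \<le> M" for t
        using r_nonneg[of t] M by (auto simp: power2_eq_square intro: mult_right_mono)
      have "(min (r t) M)\<^sup>2 \<le> r t * M" for t
        using le(1)[of t] mult_left_mono[OF le(2) r_nonneg, of t t] by linarith
      thus "integrable ?U (\<lambda>t. (min (r t) M)\<^sup>2)"
        using r_nonneg M by (intro Bochner_Integration.integrable_bound[OF dom]) auto
      show "AE t in ?U. (min (r t) M)\<^sup>2 \<le> r t * f t"
        using le(1) by (intro AE_I2) (auto simp: space_restrict_space f_def)
    qed
    ultimately have "ennreal (\<integral>t. (min (r t) M)\<^sup>2 \<partial>?U) \<le> Limsup at_top (\<lambda>s. F s / ennreal (2 * s))"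
      by (elim order_trans[rotated]) (intro ennreal_leI, linarith)
    moreover have "(\<integral>\<^sup>+t. ennreal ((min (r t) M)\<^sup>2) \<partial>?U) = ennreal (\<integral>t. (min (r t) M)\<^sup>2 \<partial>?U)"
    proof (rule nn_integral_eq_integral)
      have "integrable ?U (\<lambda>t. M\<^sup>2)"
        by (intro finite_measure.integrable_const finite_measureI)
           (simp add: emeasure_restrict_space space_restrict_space)
      thus "integrable ?U (\<lambda>t. (min (r t) M)\<^sup>2)"
        using r_nonneg M by (elim Bochner_Integration.integrable_bound) (auto intro!: power_mono)
    qed auto
    ultimately show ?thesis by simp
  qed

  \<comment> \<open>Monotone convergence removes the truncation; the limit may be infinite.\<close>
  have "(\<lambda>n. \<integral>\<^sup>+t. ennreal ((min (r t) (real n))\<^sup>2) \<partial>?U) \<longlonglongrightarrow> (\<integral>\<^sup>+t. ennreal ((r t)\<^sup>2) \<partial>?U)"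
  proof (rule nn_integral_LIMSEQ)
    show "incseq (\<lambda>n t. ennreal ((min (r t) (real n))\<^sup>2))"
      using r_nonneg by (auto simp: incseq_def le_fun_def intro!: ennreal_leI power_mono)
    show "(\<lambda>n. ennreal ((min (r t) (real n))\<^sup>2)) \<longlonglongrightarrow> ennreal ((r t)\<^sup>2)" for t
    proof (rule tendsto_eventually, rule eventually_sequentiallyI)
      fix n assume "nat \<lceil>r t\<rceil> \<le> n"
      hence "r t \<le> real n" by linarith
      thus "ennreal ((min (r t) (real n))\<^sup>2) = ennreal ((r t)\<^sup>2)" by simp
    qed
  qed auto
  hence "(\<integral>\<^sup>+t. ennreal ((r t)\<^sup>2) \<partial>?U) \<le> Limsup at_top (\<lambda>s. F s / ennreal (2 * s))"
    by (rule LIMSEQ_le_const2) (auto intro!: trunc)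
  moreover have "(\<integral>\<^sup>+t. (g t)\<^sup>2 \<partial>?U) = (\<integral>\<^sup>+t. ennreal ((r t)\<^sup>2) \<partial>?U)"
    using g_r by (intro nn_integral_cong_AE, eventually_elim) (simp add: ennreal_power r_nonneg)
  ultimately show ?thesis by simp
qed

end

theorem theorem2:
  fixes x :: "nat \<Rightarrow> real" and G :: "real \<Rightarrow> real" and F :: "real \<Rightarrow> ennreal"
  assumes x_range: "\<And>n. 1 \<le> n \<Longrightarrow> x n \<in> {0..1}"
    and G_lim: "\<And>t. t \<in> {0..1} \<Longrightarrow>
      (\<lambda>N. real (card {n \<in> {1..N}. x n \<in> {0..t}}) / real N) \<longlonglongrightarrow> G t"
    and F_lim: "\<And>s. 0 < s \<Longrightarrow>
      (\<lambda>N. ennreal (real (pair_count x s N) / real N)) \<longlonglongrightarrow> F s"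
  shows "(\<not> abs_cont_cdf G \<longrightarrow> (\<forall>s>0. F s = \<infinity>)) \<and>
         (abs_cont_cdf G \<longrightarrow>
           (\<forall>g. is_density_of g G \<longrightarrow>
             Limsup at_top (\<lambda>s. F s / ennreal (2 * s)) \<ge> (\<integral>\<^sup>+ t. (g t)\<^sup>2 \<partial>unit_lebesgue)))"
proof -
  interpret pair_correlation x G F
    using assms by unfold_locales auto
  show ?thesis using F_eq_infinity integral_density_le_Limsup by blast
qed

end
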